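(* Let $\alpha\ge-\frac12$, $d_\alpha=2\alpha+2$, $\gamma>0$, $0<\beta<d_\alpha$, and let $K_{\beta,\gamma}^\alpha(x)=\frac{|x|^{\beta-d_\alpha}}{(1+|x|)^\gamma}$. If $\frac{d_\alpha}{d_\alpha+\gamma-\beta}<t<\frac{d_\alpha}{d_\alpha-\beta}$, then $K_{\beta,\gamma}^\alpha\in L^t(\mathbb{R},d\mu_\alpha)$ and, for any $R>0$, $$\|K_{\beta,\gamma}^\alpha\|_{L^t(\mathbb{R},d\mu_\alpha)}\sim\Big(\sum_{k\in\mathbb{Z}}\frac{(2^kR)^{(\beta-d_\alpha)t+d_\alpha}}{(1+2^kR)^{\gamma t}}\Big)^{1/t},$$ i.e. each side is bounded by a positive constant, independent of $R$, times the other.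
   Context: $d\mu_\alpha(x)=A_\alpha|x|^{2\alpha+1}dx$ on $\mathbb{R}$ with $A_\alpha=(2^{\alpha+1}\Gamma(\alpha+1))^{-1}$, and $\|f\|_{L^t(\mathbb{R},d\mu_\alpha)}=\big(\int_{\mathbb{R}}|f|^t\,d\mu_\alpha\big)^{1/t}$; $f\in L^t(\mathbb{R},d\mu_\alpha)$ means this quantity is finite. *)

theory Defs
  imports "HOL-Analysis.Analysis"
begin

definition hdim :: "real \<Rightarrow> real" where
  "hdim \<alpha> = 2 * \<alpha> + 2"

definition A_const :: "real \<Rightarrow> real" where
  "A_const \<alpha> = 1 / (2 powr (\<alpha> + 1) * Gamma (\<alpha> + 1))"

(* The convention 0 powr a = 0 affects the density (for alpha = -1/2) and the kernel K
   below only at x = 0, a null set. *)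
definition mu :: "real \<Rightarrow> real measure" where
  "mu \<alpha> = density lborel (\<lambda>x. ennreal (A_const \<alpha> * \<bar>x\<bar> powr (2 * \<alpha> + 1)))"

definition Lt_space :: "real \<Rightarrow> real \<Rightarrow> (real \<Rightarrow> real) set" where
  "Lt_space \<alpha> t =
     {f. f \<in> borel_measurable (mu \<alpha>) \<and> integrable (mu \<alpha>) (\<lambda>x. \<bar>f x\<bar> powr t)}"

(* Meaningful for f in Lt_space alpha t; otherwise the Bochner integral defaults to 0. *)
definition Lt_norm :: "real \<Rightarrow> real \<Rightarrow> (real \<Rightarrow> real) \<Rightarrow> real" where
  "Lt_norm \<alpha> t f = (LINT x|mu \<alpha>. \<bar>f x\<bar> powr t) powr (1 / t)"

definition K :: "real \<Rightarrow> real \<Rightarrow> real \<Rightarrow> real \<Rightarrow> real" where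
  "K \<alpha> \<beta> \<gamma> x = \<bar>x\<bar> powr (\<beta> - hdim \<alpha>) / (1 + \<bar>x\<bar>) powr \<gamma>"

definition dyadic_term ::
    "real \<Rightarrow> real \<Rightarrow> real \<Rightarrow> real \<Rightarrow> real \<Rightarrow> int \<Rightarrow> real" where
  "dyadic_term \<alpha> \<beta> \<gamma> t R k =
     (2 powi k * R) powr ((\<beta> - hdim \<alpha>) * t + hdim \<alpha>) / (1 + 2 powi k * R) powr (\<gamma> * t)"

end

theory Submission
  imports Defs
begin

text \<open>
  Write \<open>d = hdim \<alpha>\<close>, \<open>b = (\<beta> - d) * t + d\<close> and \<open>c = \<gamma> * t\<close>.  The weight of the measure has
  exponent \<open>2 * \<alpha> + 1 = d - 1\<close>, so the \<open>t\<close>-th power of the kernel times the density of the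
  measure is a constant times \<open>g \<bar>x\<bar> / \<bar>x\<bar>\<close>, where \<open>g y = y powr b / (1 + y) powr c\<close>, and the
  terms of the series are exactly the values \<open>g (2 powi k * R)\<close>.  The two bounds on \<open>t\<close> say
  precisely that \<open>0 < b < c\<close>.

  Hence the claim compares the integral of \<open>g\<close> against the dilation invariant measure
  \<open>dx / \<bar>x\<bar>\<close> with its samples along a geometric progression.  On the dyadic shell
  \<open>y \<le> \<bar>x\<bar> < 2 * y\<close> the function \<open>g\<close> changes at most by factors that depend on \<open>b\<close> and \<open>c\<close> only
  (\<open>profile_dyadic_bounds\<close>), and the shell has a \<open>dx / \<bar>x\<bar>\<close>-mass between \<open>1\<close> and \<open>2\<close>, whatever \<open>y\<close>
  is.  So its contribution is comparable to \<open>g y\<close> uniformly in \<open>y\<close> (\<open>shell_integral_bounds\<close>), and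
  summation over the shells with \<open>y = 2 powi k * R\<close> gives two-sided bounds with constants
  independent of \<open>R\<close> (\<open>integral_comparable_dyadic_sum\<close>).

  The series converges because \<open>g y \<le> y powr b\<close> and \<open>g y \<le> y powr (b - c)\<close>: these are
  geometric bounds with positive exponent towards \<open>0\<close> and negative exponent towards infinity
  (\<open>profile_dyadic_summable\<close>).  Through the comparison, its finiteness gives integrability of the
  kernel as well.
\<close>

section \<open>The radial profile on dyadic scales\<close>

definition profile :: "real \<Rightarrow> real \<Rightarrow> real \<Rightarrow> real" where
  "profile b c y = y powr b / (1 + y) powr c"

lemma profile_nonneg: "profile b c y \<ge> 0"
  by (simp add: profile_def)

text \<open>
  Between \<open>y\<close> and \<open>2 * y\<close>, the numerator grows by at most \<open>2 powr b\<close> and, since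
  \<open>1 + 2 * y \<le> 2 * (1 + y)\<close>, the denominator grows by at most \<open>2 powr c\<close>.
\<close>

lemma profile_dyadic_bounds:
  assumes "b > 0" "c > 0" "y > 0" "y \<le> x" "x \<le> 2 * y"
  shows "2 powr (- c) * profile b c y \<le> profile b c x"
    and "profile b c x \<le> 2 powr b * profile b c y"
proof -
  have num: "y powr b \<le> x powr b" "x powr b \<le> 2 powr b * y powr b"
    using assms powr_mono2[of b x "2 * y"] by (auto intro!: powr_mono2 simp: powr_mult)
  have "(1 + x) powr c \<le> (2 * (1 + y)) powr c"
    using assms by (intro powr_mono2) auto
  hence den: "(1 + x) powr c \<le> 2 powr c * (1 + y) powr c"
    using powr_mult[of 2 "1 + y" c] assms by simp
  have den': "(1 + y) powr c \<le> (1 + x) powr c"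
    using assms by (intro powr_mono2) auto
  have "2 powr (- c) * profile b c y = y powr b / (2 powr c * (1 + y) powr c)"
    by (simp add: profile_def powr_minus field_simps)
  also have "\<dots> \<le> x powr b / (1 + x) powr c"
    using assms num den by (intro frac_le) auto
  finally show "2 powr (- c) * profile b c y \<le> profile b c x"
    by (simp add: profile_def)
  have "x powr b / (1 + x) powr c \<le> (2 powr b * y powr b) / (1 + y) powr c"
    using assms num den' by (intro frac_le) auto
  thus "profile b c x \<le> 2 powr b * profile b c y"
    by (simp add: profile_def)
qed

lemma profile_le_powr:
  assumes "c > 0" "y > 0"
  shows "profile b c y \<le> y powr b" and "profile b c y \<le> y powr (b - c)"
proof -
  have "1 \<le> (1 + y) powr c" "y powr c \<le> (1 + y) powr c"
    using assms by (auto intro!: powr_mono2 ge_one_powr_ge_zero)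
  hence "profile b c y \<le> y powr b / 1" "profile b c y \<le> y powr b / y powr c"
    unfolding profile_def using assms by (intro frac_le; simp)+
  thus "profile b c y \<le> y powr b" "profile b c y \<le> y powr (b - c)"
    by (simp_all add: powr_diff)
qed

lemma power_powr_commute:
  fixes x a :: real
  assumes "x > 0"
  shows "(x ^ n) powr a = (x powr a) ^ n"
  using assms by (induction n) (auto simp: powr_mult)

text \<open>
  The integers split into two copies of the natural numbers, on each of which one of the two
  power bounds is a convergent geometric series.
\<close>

lemma profile_dyadic_summable:
  assumes "0 < b" "b < c" "R > 0"
  shows "(\<lambda>k::int. profile b c (2 powi k * R)) summable_on UNIV"
proof -
  let ?f = "\<lambda>k::int. profile b c (2 powi k * R)"
  have "(\<lambda>n. ?f (int n)) summable_on UNIV"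
  proof (rule summable_nonneg_imp_summable_on)
    have "(2::real) powr (b - c) < 1"
      using assms by (simp add: powr_less_one)
    hence geo: "summable (\<lambda>n. R powr (b - c) * (2 powr (b - c)) ^ n)"
      by (intro summable_mult summable_geometric) auto
    have "?f (int n) \<le> R powr (b - c) * (2 powr (b - c)) ^ n" for n
    proof -
      have "?f (int n) \<le> (2 ^ n * R) powr (b - c)"
        using profile_le_powr(2)[of c "2 ^ n * R" b] assms by simp
      also have "\<dots> = R powr (b - c) * (2 powr (b - c)) ^ n"
        using assms by (simp add: powr_mult power_powr_commute)
      finally show ?thesis .
    qed
    thus "summable (\<lambda>n. ?f (int n))"
      by (intro summable_comparison_test'[OF geo, of 0]) (simp add: profile_nonneg)
  qed (simp add: profile_nonneg)
  hence 1: "?f summable_on (range int)"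
    by (subst summable_on_reindex) (auto simp: o_def)
  have "(\<lambda>n. ?f (- int n)) summable_on UNIV"
  proof (rule summable_nonneg_imp_summable_on)
    have "(1 / 2 :: real) powr b < 1"
      using assms by (simp add: powr_divide)
    hence geo: "summable (\<lambda>n. R powr b * ((1 / 2) powr b) ^ n)"
      by (intro summable_mult summable_geometric) auto
    have "?f (- int n) \<le> R powr b * ((1 / 2) powr b) ^ n" for n
    proof -
      have "?f (- int n) \<le> ((1 / 2) ^ n * R) powr b"
        using profile_le_powr(1)[of c "(1 / 2) ^ n * R" b] assms
        by (simp add: power_int_minus power_one_over inverse_eq_divide)
      also have "\<dots> = R powr b * ((1 / 2) powr b) ^ n"
        using assms by (simp add: powr_mult power_powr_commute del: power_divide power_one_over)
      finally show ?thesis .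
    qed
    thus "summable (\<lambda>n. ?f (- int n))"
      by (intro summable_comparison_test'[OF geo, of 0]) (simp add: profile_nonneg)
  qed (simp add: profile_nonneg)
  hence 2: "?f summable_on (range (\<lambda>n. - int n))"
    by (subst summable_on_reindex) (auto simp: o_def inj_on_def)
  have "(UNIV :: int set) = range int \<union> range (\<lambda>n. - int n)"
  proof -
    have "k \<in> range int \<union> range (\<lambda>n. - int n)" for k
      by (cases k rule: int_cases2) auto
    thus ?thesis by blast
  qed
  with summable_on_union[OF 1 2] show ?thesis by simp
qed

section \<open>Integration over dyadic shells\<close>

text \<open>
  The exponent of \<open>2\<close> is read off with a rounded-down logarithm instead of inequalities on \<open>\<bar>x\<bar>\<close>, so
  that the shells visibly form a partition of the nonzero reals.
\<close>

definition shell :: "real \<Rightarrow> int \<Rightarrow> real set" where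
  "shell R k = {x. x \<noteq> 0 \<and> \<lfloor>log 2 (\<bar>x\<bar> / R)\<rfloor> = k}"

lemma shell_eq_intervals:
  assumes "R > 0"
  shows "shell R k = {2 powi k * R ..< 2 * (2 powi k * R)}
                 \<union> {- (2 * (2 powi k * R)) <.. - (2 powi k * R)}"
proof -
  define y where "y = 2 powi k * R"
  have y: "y > 0" using assms by (simp add: y_def)
  have mem: "x \<in> shell R k \<longleftrightarrow> y \<le> \<bar>x\<bar> \<and> \<bar>x\<bar> < 2 * y" for x
  proof (cases "x = 0")
    case False
    hence "x \<in> shell R k \<longleftrightarrow> 2 powr k \<le> \<bar>x\<bar> / R \<and> \<bar>x\<bar> / R < 2 powr (k + 1)"
      using assms by (simp add: shell_def floor_log_eq_powr_iff)
    also have "\<dots> \<longleftrightarrow> y \<le> \<bar>x\<bar> \<and> \<bar>x\<bar> < 2 * y"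
      using assms by (simp add: y_def powr_real_of_int' powr_add field_simps)
    finally show ?thesis .
  qed (use y in \<open>auto simp: shell_def\<close>)
  have "x \<in> shell R k \<longleftrightarrow> x \<in> {y ..< 2 * y} \<union> {- (2 * y) <.. - y}" for x
    unfolding mem using y by (cases "x \<ge> 0") auto
  thus ?thesis unfolding y_def by blast
qed

lemma shell_measurable: "R > 0 \<Longrightarrow> shell R k \<in> sets borel"
  by (simp add: shell_eq_intervals)

lemma emeasure_shell:
  assumes "R > 0"
  shows "emeasure lborel (shell R k) = ennreal (2 * (2 powi k * R))"
proof -
  define y where "y = 2 powi k * R"
  have y: "y > 0" using assms by (simp add: y_def)
  have "emeasure lborel ({y ..< 2 * y} \<union> {- (2 * y) <.. - y})
      = emeasure lborel {y ..< 2 * y} + emeasure lborel {- (2 * y) <.. - y}"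
    using y by (intro plus_emeasure[symmetric]) auto
  also have "\<dots> = ennreal (2 * y)"
    using y by (simp add: ennreal_plus[symmetric] del: ennreal_plus)
  finally show ?thesis using assms by (simp add: shell_eq_intervals y_def)
qed

text \<open>
  With \<open>y = 2 powi k * R\<close>, the shell has Lebesgue measure \<open>2 * y\<close> while \<open>1 / \<bar>x\<bar>\<close> lies between
  \<open>1 / (2 * y)\<close> and \<open>1 / y\<close>; the scale \<open>y\<close> cancels.
\<close>

lemma shell_integral_bounds:
  assumes "b > 0" "c > 0" "R > 0"
  defines "I \<equiv> (\<lambda>k. \<integral>\<^sup>+x\<in>shell R k. ennreal (profile b c \<bar>x\<bar> / \<bar>x\<bar>) \<partial>lborel)"
  shows "ennreal (2 powr (- c) * profile b c (2 powi k * R)) \<le> I k"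
    and "I k \<le> ennreal (2 powr (b + 1) * profile b c (2 powi k * R))"
proof -
  define y where "y = 2 powi k * R"
  have y: "y > 0" using assms by (simp add: y_def)
  let ?g = "profile b c"
  have const: "(\<integral>\<^sup>+x\<in>shell R k. ennreal m \<partial>lborel) = ennreal (m * (2 * y))" if "m \<ge> 0" for m
    using assms(3) y that
    by (simp add: nn_integral_cmult_indicator shell_measurable emeasure_shell y_def
        ennreal_mult[symmetric])
  have pt: "2 powr (- c) * ?g y / (2 * y) \<le> ?g \<bar>x\<bar> / \<bar>x\<bar>"
           "?g \<bar>x\<bar> / \<bar>x\<bar> \<le> 2 powr b * ?g y / y" if "x \<in> shell R k" for x
  proof -
    have x: "y \<le> \<bar>x\<bar>" "\<bar>x\<bar> \<le> 2 * y"
      using that assms(3) y by (auto simp: shell_eq_intervals y_def[symmetric])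
    note B = profile_dyadic_bounds[OF assms(1,2) y x]
    show "2 powr (- c) * ?g y / (2 * y) \<le> ?g \<bar>x\<bar> / \<bar>x\<bar>"
      using B(1) x y by (intro frac_le) (auto simp: profile_nonneg)
    show "?g \<bar>x\<bar> / \<bar>x\<bar> \<le> 2 powr b * ?g y / y"
      using B(2) x y by (intro frac_le) (auto simp: profile_nonneg)
  qed
  have "ennreal (2 powr (- c) * ?g y) = (\<integral>\<^sup>+x\<in>shell R k. ennreal (2 powr (- c) * ?g y / (2 * y)) \<partial>lborel)"
    using y by (subst const) (auto simp: profile_nonneg)
  also have "\<dots> \<le> I k"
    unfolding I_def using pt(1) by (intro nn_integral_mono) (auto simp: indicator_def intro: ennreal_leI)
  finally show "ennreal (2 powr (- c) * ?g (2 powi k * R)) \<le> I k" by (simp add: y_def)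
  have "I k \<le> (\<integral>\<^sup>+x\<in>shell R k. ennreal (2 powr b * ?g y / y) \<partial>lborel)"
    unfolding I_def using pt(2) by (intro nn_integral_mono) (auto simp: indicator_def intro: ennreal_leI)
  also have "\<dots> = ennreal (2 powr (b + 1) * ?g y)"
    using y by (subst const) (auto simp: profile_nonneg powr_add mult_ac)
  finally show "I k \<le> ennreal (2 powr (b + 1) * ?g (2 powi k * R))" by (simp add: y_def)
qed

text \<open>
  Countable additivity of the measure with density \<open>f\<close>: the shells are disjoint and miss only the
  null set \<open>{0}\<close>.
\<close>

lemma nn_integral_eq_sum_shells:
  fixes f :: "real \<Rightarrow> ennreal"
  assumes [measurable]: "f \<in> borel_measurable borel" and "R > 0"
  shows "(\<integral>\<^sup>+x. f x \<partial>lborel)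
       = (\<integral>\<^sup>+k. (\<integral>\<^sup>+x\<in>shell R k. f x \<partial>lborel) \<partial>count_space UNIV)"
proof -
  let ?N = "density lborel f"
  have ms [measurable]: "shell R k \<in> sets borel" for k
    by (rule shell_measurable[OF assms(2)])
  have cover: "(\<Union>k. shell R k) = - {0}"
    by (auto simp: shell_def)
  have "(\<integral>\<^sup>+x. f x \<partial>lborel) = (\<integral>\<^sup>+x. f x * indicator (- {0}) x \<partial>lborel)"
  proof (rule nn_integral_cong_AE)
    have "AE x in lborel. x \<noteq> (0::real)" by (rule AE_lborel_singleton)
    thus "AE x in lborel. f x = f x * indicator (- {0}) x"
      by eventually_elim auto
  qed
  also have "\<dots> = emeasure ?N (\<Union>k. shell R k)"
    by (simp add: cover emeasure_density)
  also have "\<dots> = (\<integral>\<^sup>+k. emeasure ?N (shell R k) \<partial>count_space UNIV)"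
    by (rule emeasure_UN_countable) (auto simp: disjoint_family_on_def shell_def ms[unfolded shell_def])
  also have "\<dots> = (\<integral>\<^sup>+k. (\<integral>\<^sup>+x\<in>shell R k. f x \<partial>lborel) \<partial>count_space UNIV)"
    by (simp add: emeasure_density)
  finally show ?thesis .
qed

lemma nn_integral_count_space_eq_infsum:
  assumes "f summable_on A" and "\<And>x. f x \<ge> (0::real)"
  shows "(\<integral>\<^sup>+x. ennreal (f x) \<partial>count_space A) = ennreal (\<Sum>\<^sub>\<infinity>x\<in>A. f x)"
proof -
  note abs = abs_summable_equivalent[THEN iffD1,
      OF summable_on_iff_abs_summable_on_real[THEN iffD1, OF assms(1)]]
  show ?thesis
    using assms(2) by (simp add: nn_integral_conv_infsetsum[OF abs] infsetsum_infsum[OF abs])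
qed

text \<open>
  The integral on the left does not involve \<open>R\<close>, so all the dyadic sums are comparable to one
  number, with the constants of a single shell.
\<close>

lemma integral_comparable_dyadic_sum:
  assumes "0 < b" "b < c" "R > 0"
  defines "J \<equiv> (\<integral>\<^sup>+x. ennreal (profile b c \<bar>x\<bar> / \<bar>x\<bar>) \<partial>lborel)"
  defines "S \<equiv> (\<Sum>\<^sub>\<infinity>k::int. profile b c (2 powi k * R))"
  shows "ennreal (2 powr (- c) * S) \<le> J" and "J \<le> ennreal (2 powr (b + 1) * S)"
proof -
  let ?I = "\<lambda>k. \<integral>\<^sup>+x\<in>shell R k. ennreal (profile b c \<bar>x\<bar> / \<bar>x\<bar>) \<partial>lborel"
  have c: "c > 0" using assms by simp
  have J: "J = (\<integral>\<^sup>+k. ?I k \<partial>count_space UNIV)"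
    unfolding J_def using assms(3)
    by (intro nn_integral_eq_sum_shells) (auto simp: profile_def)
  have S: "(\<integral>\<^sup>+k. ennreal (a * profile b c (2 powi k * R)) \<partial>count_space UNIV) = ennreal (a * S)"
    if "a \<ge> 0" for a
    unfolding S_def infsum_cmult_right'[symmetric]
    using that profile_dyadic_summable[OF assms(1-3)]
    by (intro nn_integral_count_space_eq_infsum summable_on_cmult_right)
       (auto simp: profile_nonneg)
  show "ennreal (2 powr (- c) * S) \<le> J"
    unfolding J using shell_integral_bounds(1)[OF assms(1) c assms(3)]
    by (subst S[symmetric]) (auto intro!: nn_integral_mono)
  show "J \<le> ennreal (2 powr (b + 1) * S)"
    unfolding J using shell_integral_bounds(2)[OF assms(1) c assms(3)]
    by (subst S[symmetric]) (auto intro!: nn_integral_mono)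
qed

section \<open>The kernel\<close>

lemma dyadic_term_eq_profile:
  "dyadic_term \<alpha> \<beta> \<gamma> t R k
     = profile ((\<beta> - hdim \<alpha>) * t + hdim \<alpha>) (\<gamma> * t) (2 powi k * R)"
  by (simp add: dyadic_term_def profile_def)

lemma A_const_pos: "\<alpha> > - 1 \<Longrightarrow> A_const \<alpha> > 0"
  by (simp add: A_const_def Gamma_real_pos)

text \<open>
  For \<open>x \<noteq> 0\<close> this is the identity \<open>(2 * \<alpha> + 1) + (\<beta> - d) * t = b - 1\<close> of exponents.  At \<open>x = 0\<close>
  both sides vanish, since \<open>0 powr a = 0\<close> and \<open>0 / 0 = 0\<close>.
\<close>

lemma weight_times_kernel_power:
  "A_const \<alpha> * \<bar>x\<bar> powr (2 * \<alpha> + 1) * \<bar>K \<alpha> \<beta> \<gamma> x\<bar> powr t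
     = A_const \<alpha> * (profile ((\<beta> - hdim \<alpha>) * t + hdim \<alpha>) (\<gamma> * t) \<bar>x\<bar> / \<bar>x\<bar>)"
proof (cases "x = 0")
  case False
  have kernel: "\<bar>K \<alpha> \<beta> \<gamma> x\<bar> powr t = \<bar>x\<bar> powr ((\<beta> - hdim \<alpha>) * t) / (1 + \<bar>x\<bar>) powr (\<gamma> * t)"
    by (simp add: K_def powr_divide powr_powr)
  have "\<bar>x\<bar> powr (2 * \<alpha> + 1) * \<bar>x\<bar> powr ((\<beta> - hdim \<alpha>) * t)
      = \<bar>x\<bar> powr ((\<beta> - hdim \<alpha>) * t + hdim \<alpha> - 1)"
    by (simp add: powr_add[symmetric] hdim_def algebra_simps)
  also have "\<dots> = \<bar>x\<bar> powr ((\<beta> - hdim \<alpha>) * t + hdim \<alpha>) / \<bar>x\<bar>"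
    using False by (simp add: powr_diff)
  finally show ?thesis by (simp add: kernel profile_def mult.assoc mult.commute[of "\<bar>x\<bar>"])
qed (simp add: K_def)

lemma nn_integral_kernel_power:
  assumes "\<alpha> > - 1"
  shows "(\<integral>\<^sup>+x. ennreal (\<bar>K \<alpha> \<beta> \<gamma> x\<bar> powr t) \<partial>mu \<alpha>)
       = ennreal (A_const \<alpha>) *
         (\<integral>\<^sup>+x. ennreal (profile ((\<beta> - hdim \<alpha>) * t + hdim \<alpha>) (\<gamma> * t) \<bar>x\<bar> / \<bar>x\<bar>) \<partial>lborel)"
proof -
  have A: "A_const \<alpha> \<ge> 0" using A_const_pos[OF assms] by simp
  have "(\<integral>\<^sup>+x. ennreal (\<bar>K \<alpha> \<beta> \<gamma> x\<bar> powr t) \<partial>mu \<alpha>)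
      = (\<integral>\<^sup>+x. ennreal (A_const \<alpha> * \<bar>x\<bar> powr (2 * \<alpha> + 1)) * ennreal (\<bar>K \<alpha> \<beta> \<gamma> x\<bar> powr t) \<partial>lborel)"
    unfolding mu_def by (rule nn_integral_density) (auto simp: K_def)
  also have "\<dots> = (\<integral>\<^sup>+x. ennreal (A_const \<alpha>) *
      ennreal (profile ((\<beta> - hdim \<alpha>) * t + hdim \<alpha>) (\<gamma> * t) \<bar>x\<bar> / \<bar>x\<bar>) \<partial>lborel)"
    using A by (simp add: ennreal_mult'[symmetric] weight_times_kernel_power)
  also have "\<dots> = ennreal (A_const \<alpha>) *
         (\<integral>\<^sup>+x. ennreal (profile ((\<beta> - hdim \<alpha>) * t + hdim \<alpha>) (\<gamma> * t) \<bar>x\<bar> / \<bar>x\<bar>) \<partial>lborel)"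
    by (rule nn_integral_cmult) (auto simp: profile_def)
  finally show ?thesis .
qed

theorem lemma4p1:
  fixes \<alpha> \<beta> \<gamma> t :: real
  assumes "\<alpha> \<ge> - 1 / 2"
    and "\<gamma> > 0"
    and "0 < \<beta>" and "\<beta> < hdim \<alpha>"
    and "hdim \<alpha> / (hdim \<alpha> + \<gamma> - \<beta>) < t" and "t < hdim \<alpha> / (hdim \<alpha> - \<beta>)"
  shows "K \<alpha> \<beta> \<gamma> \<in> Lt_space \<alpha> t \<and>
    (\<forall>R>0. dyadic_term \<alpha> \<beta> \<gamma> t R summable_on UNIV) \<and>
    (\<exists>C1>0. \<exists>C2>0. \<forall>R>0.
       Lt_norm \<alpha> t (K \<alpha> \<beta> \<gamma>) \<le> C1 * (\<Sum>\<^sub>\<infinity>k. dyadic_term \<alpha> \<beta> \<gamma> t R k) powr (1 / t) \<and>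
       (\<Sum>\<^sub>\<infinity>k. dyadic_term \<alpha> \<beta> \<gamma> t R k) powr (1 / t) \<le> C2 * Lt_norm \<alpha> t (K \<alpha> \<beta> \<gamma>))"
proof -
  define b where "b = (\<beta> - hdim \<alpha>) * t + hdim \<alpha>"
  define c where "c = \<gamma> * t"
  define A where "A = A_const \<alpha>"
  define S where "S = (\<lambda>R. \<Sum>\<^sub>\<infinity>k. dyadic_term \<alpha> \<beta> \<gamma> t R k)"
  define F where "F = (\<lambda>x. \<bar>K \<alpha> \<beta> \<gamma> x\<bar> powr t)"
  have "hdim \<alpha> / (hdim \<alpha> + \<gamma> - \<beta>) > 0" using assms by simp
  hence t: "t > 0" using assms(5) by linarith
  have b: "b > 0"
    using assms(4,6) by (simp add: b_def field_simps)
  have bc: "b < c"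
    using assms(2,4,5) by (simp add: b_def c_def field_simps)
  have A: "A > 0" using assms(1) by (auto simp: A_def intro: A_const_pos)
  have terms: "dyadic_term \<alpha> \<beta> \<gamma> t R = (\<lambda>k. profile b c (2 powi k * R))" for R
    by (auto simp: dyadic_term_eq_profile b_def c_def)
  have S0: "S R \<ge> 0" for R
    unfolding S_def terms by (intro infsum_nonneg) (auto simp: profile_nonneg)
  have Fint: "(\<integral>\<^sup>+x. ennreal (F x) \<partial>mu \<alpha>)
      = ennreal A * (\<integral>\<^sup>+x. ennreal (profile b c \<bar>x\<bar> / \<bar>x\<bar>) \<partial>lborel)"
    unfolding F_def A_def b_def c_def using assms(1) by (intro nn_integral_kernel_power) simp
  have lower: "ennreal (A * 2 powr (- c) * S R) \<le> (\<integral>\<^sup>+x. ennreal (F x) \<partial>mu \<alpha>)"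
   and upper: "(\<integral>\<^sup>+x. ennreal (F x) \<partial>mu \<alpha>) \<le> ennreal (A * 2 powr (b + 1) * S R)"
    if "R > 0" for R
    using mult_left_mono[OF integral_comparable_dyadic_sum(1)[OF b bc that], of "ennreal A"]
          mult_left_mono[OF integral_comparable_dyadic_sum(2)[OF b bc that], of "ennreal A"]
          A S0[of R]
    unfolding Fint S_def terms by (simp_all add: ennreal_mult'[symmetric] mult_ac)
  have Kmeas: "K \<alpha> \<beta> \<gamma> \<in> borel_measurable (mu \<alpha>)"
    unfolding mu_def K_def by simp
  \<comment> \<open>Any single value of \<open>R\<close> shows that the norm is finite.\<close>
  have Fi: "integrable (mu \<alpha>) F"
  proof (rule integrableI_bounded)
    show "F \<in> borel_measurable (mu \<alpha>)" unfolding F_def using Kmeas by simp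
    have "(\<integral>\<^sup>+x. ennreal (norm (F x)) \<partial>mu \<alpha>) \<le> ennreal (A * 2 powr (b + 1) * S 1)"
      using upper[of 1] by (simp add: F_def)
    also have "\<dots> < \<infinity>" by simp
    finally show "(\<integral>\<^sup>+x. ennreal (norm (F x)) \<partial>mu \<alpha>) < \<infinity>" .
  qed
  define J where "J = (LINT x|mu \<alpha>. F x)"
  have J0: "J \<ge> 0" unfolding J_def F_def by simp
  have J: "(\<integral>\<^sup>+x. ennreal (F x) \<partial>mu \<alpha>) = ennreal J"
    unfolding J_def using Fi by (intro nn_integral_eq_integral) (auto simp: F_def)
  have norm: "Lt_norm \<alpha> t (K \<alpha> \<beta> \<gamma>) = J powr (1 / t)"
    by (simp add: Lt_norm_def J_def F_def)
  have 1: "J powr (1 / t) \<le> (A * 2 powr (b + 1)) powr (1 / t) * S R powr (1 / t)" if "R > 0" for R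
  proof -
    have "J \<le> A * 2 powr (b + 1) * S R"
      using upper[OF that] A S0[of R] unfolding J by (subst (asm) ennreal_le_iff) auto
    hence "J powr (1 / t) \<le> (A * 2 powr (b + 1) * S R) powr (1 / t)"
      using t J0 by (intro powr_mono2) auto
    thus ?thesis using A S0[of R] by (simp add: powr_mult)
  qed
  have 2: "S R powr (1 / t) \<le> (2 powr c / A) powr (1 / t) * J powr (1 / t)" if "R > 0" for R
  proof -
    have "A * 2 powr (- c) * S R \<le> J"
      using lower[OF that] J0 unfolding J by (subst (asm) ennreal_le_iff) auto
    hence "S R \<le> 2 powr c / A * J"
      using A by (simp add: powr_minus field_simps)
    hence "S R powr (1 / t) \<le> (2 powr c / A * J) powr (1 / t)"
      using t S0 by (intro powr_mono2) auto
    thus ?thesis using powr_mult[of "2 powr c / A" J "1 / t"] A J0 by simp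
  qed
  have "K \<alpha> \<beta> \<gamma> \<in> Lt_space \<alpha> t"
    using Kmeas Fi by (simp add: Lt_space_def F_def)
  moreover have "\<forall>R>0. dyadic_term \<alpha> \<beta> \<gamma> t R summable_on UNIV"
    unfolding terms using profile_dyadic_summable[OF b bc] by blast
  moreover have "(A * 2 powr (b + 1)) powr (1 / t) > 0" "(2 powr c / A) powr (1 / t) > 0"
    using A by auto
  ultimately show ?thesis
    using 1 2 unfolding norm S_def by blast
qed

end
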